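(* For edge label alphabet size $\sigma=1$, the maximum number of edges in a Wheeler graph with $n$ vertices is $\Theta(n)$.
   Context: A directed edge-labeled graph $G=(V,E)$ has edge set $E$ consisting of triples $(u,v,k)$ (a directed edge from $u$ to $v$ with label $k\in\{1,\dots,\sigma\}$; self-loops allowed, $E$ is a set so an identical labeled edge is not repeated). $G$ is a Wheeler graph if there is a total ordering $<_\pi$ of $V$ such that for any two edges $(u,v,k)$ and $(u',v',k')$: (i) $k<k'$ implies $v<_\pi v'$; (ii) $k=k'$ and $u<_\pi u'$ imply $v\leq_\pi v'$; and in addition every vertex of in-degree zero precedes every vertex of positive in-degree in $<_\pi$. *)

theory Defs
  imports Complex_Main "HOL-Library.Landau_Symbols"
begin

definition labeled_digraph :: "nat \<Rightarrow> 'a set \<Rightarrow> ('a \<times> 'a \<times> nat) set \<Rightarrow> bool" where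
  "labeled_digraph \<sigma> V E \<longleftrightarrow> finite V \<and> E \<subseteq> V \<times> V \<times> {1..\<sigma>}"

definition in_degree :: "('a \<times> 'a \<times> nat) set \<Rightarrow> 'a \<Rightarrow> nat" where
  "in_degree E v = card {e \<in> E. fst (snd e) = v}"

(* r is the reflexive order on V, i.e. (u, v) \<in> r means u \<le> v; the strict order is r - Id. *)
definition wheeler_order :: "'a set \<Rightarrow> ('a \<times> 'a \<times> nat) set \<Rightarrow> 'a rel \<Rightarrow> bool" where
  "wheeler_order V E r \<longleftrightarrow>
     linear_order_on V r \<and>
     (\<forall>u v k u' v' k'. (u, v, k) \<in> E \<and> (u', v', k') \<in> E \<longrightarrow>
        (k < k' \<longrightarrow> (v, v') \<in> r - Id) \<and>
        (k = k' \<and> (u, u') \<in> r - Id \<longrightarrow> (v, v') \<in> r)) \<and>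
     (\<forall>x\<in>V. \<forall>y\<in>V. in_degree E x = 0 \<and> in_degree E y > 0 \<longrightarrow> (x, y) \<in> r - Id)"

definition wheeler_graph :: "nat \<Rightarrow> 'a set \<Rightarrow> ('a \<times> 'a \<times> nat) set \<Rightarrow> bool" where
  "wheeler_graph \<sigma> V E \<longleftrightarrow> labeled_digraph \<sigma> V E \<and> (\<exists>r. wheeler_order V E r)"

definition wheeler_edge_counts :: "'a itself \<Rightarrow> nat \<Rightarrow> nat \<Rightarrow> nat set" where
  "wheeler_edge_counts _ \<sigma> n =
     {card E |(V :: 'a set) E. wheeler_graph \<sigma> V E \<and> card V = n}"

definition max_wheeler_edges :: "'a itself \<Rightarrow> nat \<Rightarrow> nat \<Rightarrow> nat" where
  "max_wheeler_edges T \<sigma> n = Max (wheeler_edge_counts T \<sigma> n)"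

(* Max is unspecified on infinite or empty sets; the next two lemmas exclude these cases. *)
lemma finite_wheeler_edge_counts: "finite (wheeler_edge_counts T \<sigma> n)"
proof (rule finite_subset)
  show "wheeler_edge_counts T \<sigma> n \<subseteq> {..n * (n * \<sigma>)}"
  proof
    fix m assume "m \<in> wheeler_edge_counts T \<sigma> n"
    then obtain V :: "'a set" and E where m: "m = card E" and n: "card V = n"
      and fin: "finite V" and E: "E \<subseteq> V \<times> V \<times> {1..\<sigma>}"
      by (auto simp: wheeler_edge_counts_def wheeler_graph_def labeled_digraph_def)
    have "card E \<le> card (V \<times> V \<times> {1..\<sigma>})"
      by (rule card_mono) (use fin E in auto)
    then show "m \<in> {..n * (n * \<sigma>)}"
      using m n by (simp add: card_cartesian_product)
  qed
qed simp

lemma wheeler_edge_counts_nonempty: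
  assumes "infinite (UNIV :: 'a set)"
  shows "wheeler_edge_counts TYPE('a) \<sigma> n \<noteq> {}"
proof -
  obtain V :: "'a set" where V: "finite V" "card V = n"
    using infinite_arbitrarily_large[OF assms] by blast
  obtain r where "well_order_on V r"
    using well_order_on by blast
  then have "wheeler_graph \<sigma> V {}"
    using V by (auto simp: wheeler_graph_def labeled_digraph_def wheeler_order_def
        in_degree_def well_order_on_def)
  then have "card ({} :: ('a \<times> 'a \<times> nat) set) \<in> wheeler_edge_counts TYPE('a) \<sigma> n"
    unfolding wheeler_edge_counts_def using V by blast
  then show ?thesis by blast
qed

end

(* Let rank be the position of a vertex in the Wheeler order. When there is only one label, the
   edges form a chain in the product order on V \<times> V, so rank u + rank v determines the edge (u, v)
   and takes at most 2 n values. Conversely, one self-loop at each vertex gives a Wheeler graph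
   with n edges. *)
theory Submission
  imports Defs
begin

text \<open>As \<open>r\<close> will be reflexive, \<open>x\<close> counts itself, so positions
  start at 1.\<close>

definition rank_in :: "'a set \<Rightarrow> 'a rel \<Rightarrow> 'a \<Rightarrow> nat" where
  "rank_in V r x = card {w \<in> V. (w, x) \<in> r}"

lemma rank_in_mono:
  assumes "linear_order_on V r" "finite V" "(x, y) \<in> r"
  shows "rank_in V r x \<le> rank_in V r y"
  unfolding rank_in_def
proof (rule card_mono)
  have "trans r"
    using assms(1) by (simp add: order_on_defs)
  then show "{w \<in> V. (w, x) \<in> r} \<subseteq> {w \<in> V. (w, y) \<in> r}"
    using assms(3) by (auto dest: transD)
qed (use assms(2) in simp)

text \<open>The down-set of \<open>y\<close> contains \<open>y\<close> itself, which antisymmetry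
  keeps out of the down-set of \<open>x\<close>. Finiteness turns this strict inclusion into a
  strict inequality.\<close>

lemma rank_in_strict_mono:
  assumes "linear_order_on V r" "finite V" "y \<in> V" "(x, y) \<in> r - Id"
  shows "rank_in V r x < rank_in V r y"
  unfolding rank_in_def
proof (rule psubset_card_mono)
  have "trans r" "antisym r" "refl_on V r"
    using assms(1) by (simp_all add: order_on_defs)
  then have "{w \<in> V. (w, x) \<in> r} \<subseteq> {w \<in> V. (w, y) \<in> r}" "(y, y) \<in> r" "(y, x) \<notin> r"
    using assms(3,4) by (auto dest: transD antisymD refl_onD)
  then show "{w \<in> V. (w, x) \<in> r} \<subset> {w \<in> V. (w, y) \<in> r}"
    using assms(3) by blast
qed (use assms(2) in simp)

lemma inj_on_rank_in:
  assumes "linear_order_on V r" "finite V"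
  shows "inj_on (rank_in V r) V"
proof (rule inj_onI, rule ccontr)
  fix x y assume xy: "x \<in> V" "y \<in> V" "rank_in V r x = rank_in V r y" "x \<noteq> y"
  then have "(x, y) \<in> r - Id \<or> (y, x) \<in> r - Id"
    using assms(1) by (auto simp: order_on_defs total_on_def)
  then show False
    using rank_in_strict_mono[OF assms] xy by fastforce
qed

lemma rank_in_bounds:
  assumes "linear_order_on V r" "finite V" "x \<in> V"
  shows "rank_in V r x \<in> {1..card V}"
proof -
  have "refl_on V r"
    using assms(1) by (simp add: order_on_defs)
  then have "x \<in> {w \<in> V. (w, x) \<in> r}"
    using assms(3) by (auto dest: refl_onD)
  then have "0 < rank_in V r x"
    using assms(2) unfolding rank_in_def card_gt_0_iff by auto
  moreover have "rank_in V r x \<le> card V"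
    unfolding rank_in_def by (rule card_mono) (use assms(2) in auto)
  ultimately show ?thesis
    by simp
qed

lemma wheeler_graph_card_edges_le:
  assumes "wheeler_graph 1 V E"
  shows "card E \<le> 2 * card V"
proof -
  obtain r where fin: "finite V" and E: "E \<subseteq> V \<times> V \<times> {1..1}" and w: "wheeler_order V E r"
    using assms by (auto simp: wheeler_graph_def labeled_digraph_def)
  have lin: "linear_order_on V r"
    and mono: "\<And>u v u' v' k. \<lbrakk>(u, v, k) \<in> E; (u', v', k) \<in> E; (u, u') \<in> r - Id\<rbrakk> \<Longrightarrow> (v, v') \<in> r"
    using w unfolding wheeler_order_def by blast+
  define f where "f = (\<lambda>(u, v, k :: nat). rank_in V r u + rank_in V r v)"
  \<comment> \<open>By Wheeler condition (ii), \<open>mono\<close>, a later source forces a target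
    at least as late: the first summand grows strictly and the second does not drop.\<close>
  have less: "f (u, v, k) < f (u', v', k)"
    if "(u, v, k) \<in> E" "(u', v', k) \<in> E" "(u, u') \<in> r - Id" for u v u' v' k
    using rank_in_strict_mono[OF lin fin _ that(3)] rank_in_mono[OF lin fin mono[OF that]] E that(2)
    by (auto simp: f_def)
  have "inj_on f E"
  proof (rule inj_onI)
    fix e e' assume e: "e \<in> E" "e' \<in> E" and eq: "f e = f e'"
    \<comment> \<open>The alphabet is a single letter, so both edges carry label 1 and
      \<open>less\<close> can compare them.\<close>
    obtain u v u' v' where uv: "e = (u, v, 1)" "e' = (u', v', 1)"
        "u \<in> V" "v \<in> V" "u' \<in> V" "v' \<in> V"
      using subsetD[OF E e(1)] subsetD[OF E e(2)] by auto
    have "u = u'"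
    proof (rule ccontr)
      assume "u \<noteq> u'"
      then have "(u, u') \<in> r - Id \<or> (u', u) \<in> r - Id"
        using lin uv by (auto simp: order_on_defs total_on_def)
      then show False
        using less[of u v 1 u' v'] less[of u' v' 1 u v] e eq uv by auto
    qed
    \<comment> \<open>Condition (ii) does not relate edges with a common source; here the equal
      source ranks cancel, and the rank of the target determines it.\<close>
    moreover from this have "v = v'"
      using eq uv inj_on_rank_in[OF lin fin] by (simp add: f_def inj_on_eq_iff)
    ultimately show "e = e'"
      using uv by simp
  qed
  \<comment> \<open>A sum of two positions is at least 2, so this range is one value larger than
    necessary; only the linear growth matters.\<close>
  moreover have "f ` E \<subseteq> {1..2 * card V}"
  proof
    fix m assume "m \<in> f ` E"
    then obtain u v where "u \<in> V" "v \<in> V" "m = rank_in V r u + rank_in V r v"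
      using E by (auto simp: f_def)
    then show "m \<in> {1..2 * card V}"
      using rank_in_bounds[OF lin fin, of u] rank_in_bounds[OF lin fin, of v] by simp
  qed
  ultimately show ?thesis
    using card_inj_on_le[of f E "{1..2 * card V}"] by simp
qed

text \<open>Any linear order on \<open>V\<close> works: a loop has equal source and target, so (ii)
  is immediate; with one label (i) is vacuous, and no vertex has in-degree zero.\<close>

lemma wheeler_graph_self_loops:
  assumes "finite V"
  shows "wheeler_graph 1 V ((\<lambda>v. (v, v, 1)) ` V)"
proof -
  obtain r where "well_order_on V r"
    using well_order_on by blast
  then have lin: "linear_order_on V r"
    by (simp add: well_order_on_def)
  then have "refl_on V r"
    by (simp add: order_on_defs)
  \<comment> \<open>The loop at \<open>x\<close> enters \<open>x\<close>; finiteness of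
    \<open>V\<close> excludes the default value 0 of \<open>card\<close> on infinite sets.\<close>
  have "in_degree ((\<lambda>v. (v, v, 1)) ` V) x \<noteq> 0" if "x \<in> V" for x
    using that assms by (auto simp: in_degree_def)
  then have "wheeler_order V ((\<lambda>v. (v, v, 1)) ` V) r"
    using lin \<open>refl_on V r\<close> by (fastforce simp: wheeler_order_def dest: refl_onD)
  then show ?thesis
    using assms by (auto simp: wheeler_graph_def labeled_digraph_def)
qed

text \<open>The set of edge counts is finite and nonempty, so its maximum is attained by an actual
  Wheeler graph, to which the edge bound applies.\<close>

lemma max_wheeler_edges_le:
  assumes "infinite (UNIV :: 'a set)"
  shows "max_wheeler_edges TYPE('a) 1 n \<le> 2 * n"
  using Max_in[OF finite_wheeler_edge_counts wheeler_edge_counts_nonempty[OF assms, of 1 n]]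
    wheeler_graph_card_edges_le
  by (auto simp: max_wheeler_edges_def wheeler_edge_counts_def)

lemma max_wheeler_edges_ge:
  assumes "infinite (UNIV :: 'a set)"
  shows "n \<le> max_wheeler_edges TYPE('a) 1 n"
proof -
  obtain V :: "'a set" where V: "finite V" "card V = n"
    using infinite_arbitrarily_large[OF assms] by blast
  have "card ((\<lambda>v. (v, v, 1 :: nat)) ` V) = n"
    using V by (simp add: card_image inj_on_def)
  then have "n \<in> wheeler_edge_counts TYPE('a) 1 n"
    unfolding wheeler_edge_counts_def using V wheeler_graph_self_loops by blast
  then show ?thesis
    unfolding max_wheeler_edges_def by (rule Max_ge[OF finite_wheeler_edge_counts])
qed

theorem theorem5:
  assumes "infinite (UNIV :: 'a set)"
  shows "(\<lambda>n. real (max_wheeler_edges TYPE('a) 1 n)) \<in> \<Theta>(\<lambda>n. real n)"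
proof (rule bigthetaI')
  \<comment> \<open>The constants 1 and 2 come from the loop construction and the rank sums; both
    bounds hold for every \<open>n\<close>.\<close>
  have "real (max_wheeler_edges TYPE('a) 1 n) \<le> 2 * real n" for n
    using max_wheeler_edges_le[OF assms, of n] by linarith
  then show "\<forall>\<^sub>F n in sequentially. 1 * norm (real n) \<le> norm (real (max_wheeler_edges TYPE('a) 1 n)) \<and>
      norm (real (max_wheeler_edges TYPE('a) 1 n)) \<le> 2 * norm (real n)"
    using max_wheeler_edges_ge[OF assms] by simp
qed simp_all

end
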